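(* Let $\lambda$ be a dominant integral weight, and let $I=\{(\alpha,k)\mid\alpha\in\Phi^+,\ k\in\mathbb{Z},\ 0\le k<\langle\lambda,\alpha^\vee\rangle\}$. Fix a total order $\alpha_1<\alpha_2<\cdots<\alpha_r$ on the simple roots. For $i=(\alpha,k)\in I$, write $\alpha^\vee=c_1\alpha_1^\vee+\cdots+c_r\alpha_r^\vee$ and put $$v_i=\frac{1}{\langle\lambda,\alpha^\vee\rangle}(k,c_1,\ldots,c_r)\in\mathbb{Q}^{r+1}.$$ The map $i\mapsto v_i$ is injective; give $I$ the total order defined by $i<j$ if and only if $v_i<v_j$ in the lexicographic order on $\mathbb{Q}^{r+1}$. Then the sequence $\{\beta_i\}_{i\in I}$ defined by $\beta_i=\alpha$ for $i=(\alpha,k)$ is a $\lambda$-chain.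
   Context: Root system. Let $V$ be a finite-dimensional real vector space with a nondegenerate symmetric bilinear form $\langle\cdot,\cdot\rangle$, and let $\Phi\subset V$ be the set of real roots of a complex symmetrizable Kac-Moody algebra, with simple roots $\alpha_1,\ldots,\alpha_r$. Put $\alpha^\vee=2\alpha/\langle\alpha,\alpha\rangle$ for $\alpha\in\Phi$ and $s_\alpha(v)=v-\langle v,\alpha^\vee\rangle\alpha$; let $W\subset GL(V)$ be the Weyl group generated by the $s_\alpha$, $\alpha\in\Phi$. Thus: $\alpha_1,\dots,\alpha_r$ are linearly independent; $\langle\alpha_p,\alpha_p\rangle>0$; $\langle\alpha_p,\alpha_q^\vee\rangle\in\mathbb{Z}_{\le0}$ for $p\ne q$; and $\Phi=\bigcup_p W\alpha_p$. $\Phi^+$ is the set of roots in the nonnegative span of the simple roots, and $\Phi=\Phi^+\sqcup(-\Phi^+)$. The integral weights are $\Lambda=\{v\in V\mid\langle v,\alpha_p^\vee\rangle\in\mathbb{Z},\ p=1,\dots,r\}$; a weight $\lambda\in\Lambda$ is dominant if $\langle\lambda,\alpha^\vee\rangle\ge0$ for all $\alpha\in\Phi^+$. $\lambda$-chains. A $\lambda$-chain is a family $\{\beta_i\}_{i\in I}$ of positive roots indexed by a totally ordered set $I$ such that: (1) for each $\alpha\in\Phi^+$, $\#\{i\in I\mid\beta_i=\alpha\}=\langle\lambda,\alpha^\vee\rangle$; (2) for any roots $\alpha,\beta,\gamma\in\Phi$ with $\alpha\ne\pm\beta$ and $\gamma^\vee=\alpha^\vee+k\beta^\vee$ for some integer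 $k$, and any $i\in I$ with $\beta_i=\beta$, one has $N_i(\gamma)=N_i(\alpha)+kN_i(\beta)$. Here, for $\alpha\in\Phi^+$, $N_i(\alpha)=\#\{j<i\mid\beta_j=\alpha\}$ and $N_i(-\alpha)=1-N_i(\alpha)$. *)

theory Defs
  imports "HOL-Analysis.Analysis"
begin

definition coroot :: "('v::real_vector \<Rightarrow> 'v \<Rightarrow> real) \<Rightarrow> 'v \<Rightarrow> 'v"
  where "coroot B \<alpha> = (2 / B \<alpha> \<alpha>) *\<^sub>R \<alpha>"

definition reflection :: "('v::real_vector \<Rightarrow> 'v \<Rightarrow> real) \<Rightarrow> 'v \<Rightarrow> 'v \<Rightarrow> 'v"
  where "reflection B \<alpha> v = v - B v (coroot B \<alpha>) *\<^sub>R \<alpha>"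

(* The subgroup of GL(V) generated by the reflections s_\<alpha>, \<alpha> \<in> R. Each reflection is an
   involution, so no clause for inverses is needed. *)
inductive_set reflection_group :: "('v::real_vector \<Rightarrow> 'v \<Rightarrow> real) \<Rightarrow> 'v set \<Rightarrow> ('v \<Rightarrow> 'v) set"
  for B R where
  id: "id \<in> reflection_group B R"
| refl: "\<alpha> \<in> R \<Longrightarrow> w \<in> reflection_group B R \<Longrightarrow> reflection B \<alpha> \<circ> w \<in> reflection_group B R"

(* Real roots are the images of the simple roots \<Delta> under the group generated by the simple
   reflections. This avoids the circularity of a Weyl group generated by the reflections in all
   real roots; lemma reflection_group_real_roots below shows that the latter group is the same. *)
definition real_roots :: "('v::real_vector \<Rightarrow> 'v \<Rightarrow> real) \<Rightarrow> 'v set \<Rightarrow> 'v set"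
  where "real_roots B \<Delta> = {w p | w p. w \<in> reflection_group B \<Delta> \<and> p \<in> \<Delta>}"

definition weyl_group :: "('v::real_vector \<Rightarrow> 'v \<Rightarrow> real) \<Rightarrow> 'v set \<Rightarrow> ('v \<Rightarrow> 'v) set"
  where "weyl_group B \<Delta> = reflection_group B (real_roots B \<Delta>)"

definition pos_roots :: "('v::real_vector \<Rightarrow> 'v \<Rightarrow> real) \<Rightarrow> 'v set \<Rightarrow> 'v set"
  where "pos_roots B \<Delta> =
    {\<alpha> \<in> real_roots B \<Delta>. \<exists>c. (\<forall>p\<in>\<Delta>. 0 \<le> c p) \<and> \<alpha> = (\<Sum>p\<in>\<Delta>. c p *\<^sub>R p)}"

(* sign_coherent holds for the real roots of every Kac-Moody algebra; it is recorded here
   as part of the structure. Disjointness of the two halves follows from independence. *)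
locale kac_moody_roots =
  fixes B :: "'v::real_vector \<Rightarrow> 'v \<Rightarrow> real" and \<Delta> :: "'v set"
  assumes finite_dimensional: "\<exists>S::'v set. finite S \<and> span S = UNIV"
    and form_bilinear: "bilinear B"
    and form_sym: "B x y = B y x"
    and form_nondegenerate: "(\<And>y. B x y = 0) \<Longrightarrow> x = 0"
    and finite_simple: "finite \<Delta>"
    and independent_simple: "independent \<Delta>"
    and simple_pos: "p \<in> \<Delta> \<Longrightarrow> B p p > 0"
    and cartan_int: "p \<in> \<Delta> \<Longrightarrow> q \<in> \<Delta> \<Longrightarrow> p \<noteq> q \<Longrightarrow> B p (coroot B q) \<in> \<int>"
    and cartan_nonpos: "p \<in> \<Delta> \<Longrightarrow> q \<in> \<Delta> \<Longrightarrow> p \<noteq> q \<Longrightarrow> B p (coroot B q) \<le> 0"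
    and sign_coherent: "real_roots B \<Delta> = pos_roots B \<Delta> \<union> uminus ` pos_roots B \<Delta>"

definition integral_weights :: "('v::real_vector \<Rightarrow> 'v \<Rightarrow> real) \<Rightarrow> 'v set \<Rightarrow> 'v set"
  where "integral_weights B \<Delta> = {v. \<forall>p\<in>\<Delta>. B v (coroot B p) \<in> \<int>}"

definition dominant :: "('v::real_vector \<Rightarrow> 'v \<Rightarrow> real) \<Rightarrow> 'v set \<Rightarrow> 'v \<Rightarrow> bool"
  where "dominant B \<Delta> lam \<longleftrightarrow> (\<forall>\<alpha>\<in>pos_roots B \<Delta>. B lam (coroot B \<alpha>) \<ge> 0)"

(* The number N_i(\<alpha>), for \<alpha> a real root. *)
definition chain_count ::
    "('v::real_vector \<Rightarrow> 'v \<Rightarrow> real) \<Rightarrow> 'v set \<Rightarrow> 'i set \<Rightarrow> ('i \<times> 'i) set \<Rightarrow> ('i \<Rightarrow> 'v) \<Rightarrow> 'i \<Rightarrow> 'v \<Rightarrow> int"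
  where "chain_count B \<Delta> I lt \<beta> i \<alpha> =
    (if \<alpha> \<in> pos_roots B \<Delta> then int (card {j \<in> I. (j, i) \<in> lt \<and> \<beta> j = \<alpha>})
     else 1 - int (card {j \<in> I. (j, i) \<in> lt \<and> \<beta> j = - \<alpha>}))"

(* lam is the weight \<lambda>, lt the strict total order on the index set I. *)
definition lambda_chain ::
    "('v::real_vector \<Rightarrow> 'v \<Rightarrow> real) \<Rightarrow> 'v set \<Rightarrow> 'v \<Rightarrow> 'i set \<Rightarrow> ('i \<times> 'i) set \<Rightarrow> ('i \<Rightarrow> 'v) \<Rightarrow> bool"
  where "lambda_chain B \<Delta> lam I lt \<beta> \<longleftrightarrow>
    strict_linear_order_on I lt \<and>
    (\<forall>i\<in>I. \<beta> i \<in> pos_roots B \<Delta>) \<and>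
    (\<forall>\<alpha>\<in>pos_roots B \<Delta>.
       finite {i \<in> I. \<beta> i = \<alpha>} \<and> real (card {i \<in> I. \<beta> i = \<alpha>}) = B lam (coroot B \<alpha>)) \<and>
    (\<forall>\<alpha>\<in>real_roots B \<Delta>. \<forall>\<beta>'\<in>real_roots B \<Delta>. \<forall>\<gamma>\<in>real_roots B \<Delta>. \<forall>k::int. \<forall>i\<in>I.
       \<alpha> \<noteq> \<beta>' \<longrightarrow> \<alpha> \<noteq> - \<beta>' \<longrightarrow>
       coroot B \<gamma> = coroot B \<alpha> + of_int k *\<^sub>R coroot B \<beta>' \<longrightarrow> \<beta> i = \<beta>' \<longrightarrow>
       chain_count B \<Delta> I lt \<beta> i \<gamma> =
         chain_count B \<Delta> I lt \<beta> i \<alpha> + k * chain_count B \<Delta> I lt \<beta> i \<beta>')"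

definition chain_index :: "('v::real_vector \<Rightarrow> 'v \<Rightarrow> real) \<Rightarrow> 'v set \<Rightarrow> 'v \<Rightarrow> ('v \<times> int) set"
  where "chain_index B \<Delta> lam =
    {(\<alpha>, k). \<alpha> \<in> pos_roots B \<Delta> \<and> 0 \<le> k \<and> of_int k < B lam (coroot B \<alpha>)}"

(* The coefficient c_p of the simple coroot of p in the coroot of \<alpha>; see coroot_expansion. *)
definition coroot_coeff :: "('v::real_vector \<Rightarrow> 'v \<Rightarrow> real) \<Rightarrow> 'v set \<Rightarrow> 'v \<Rightarrow> 'v \<Rightarrow> real"
  where "coroot_coeff B \<Delta> \<alpha> p = representation (coroot B ` \<Delta>) (coroot B \<alpha>) (coroot B p)"

(* The list ps enumerates the simple roots in the chosen order. *)
definition chain_vec ::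
    "('v::real_vector \<Rightarrow> 'v \<Rightarrow> real) \<Rightarrow> 'v set \<Rightarrow> 'v list \<Rightarrow> 'v \<Rightarrow> 'v \<times> int \<Rightarrow> real list"
  where "chain_vec B \<Delta> ps lam = (\<lambda>(\<alpha>, k).
    map (\<lambda>x. x / B lam (coroot B \<alpha>)) (of_int k # map (coroot_coeff B \<Delta> \<alpha>) ps))"

definition chain_less ::
    "('v::real_vector \<Rightarrow> 'v \<Rightarrow> real) \<Rightarrow> 'v set \<Rightarrow> 'v list \<Rightarrow> 'v \<Rightarrow> (('v \<times> int) \<times> ('v \<times> int)) set"
  where "chain_less B \<Delta> ps lam =
    {(i, j). i \<in> chain_index B \<Delta> lam \<and> j \<in> chain_index B \<Delta> lam \<and>
       (chain_vec B \<Delta> ps lam i, chain_vec B \<Delta> ps lam j) \<in> lexord {(x, y). x < y}}"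

lemma reflection_group_comp:
  "u \<in> reflection_group B R \<Longrightarrow> v \<in> reflection_group B R \<Longrightarrow> u \<circ> v \<in> reflection_group B R"
  by (induction rule: reflection_group.induct) (auto simp: comp_assoc intro: reflection_group.refl)

lemma reflection_group_mono:
  "w \<in> reflection_group B R \<Longrightarrow> R \<subseteq> S \<Longrightarrow> w \<in> reflection_group B S"
  by (induction rule: reflection_group.induct) (auto intro: reflection_group.intros)

context kac_moody_roots
begin

lemma form_simps [simp]:
  "B (x + y) z = B x z + B y z" "B z (x + y) = B z x + B z y"
  "B (x - y) z = B x z - B y z" "B z (x - y) = B z x - B z y"
  "B (c *\<^sub>R x) z = c * B x z" "B z (c *\<^sub>R x) = c * B z x"
  using form_bilinear by (simp_all add: bilinear_ladd bilinear_radd bilinear_lsub bilinear_rsub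
      bilinear_lmul bilinear_rmul)

lemma form_zero [simp]: "B 0 x = 0" "B x 0 = 0"
  using form_bilinear by (simp_all add: bilinear_lzero bilinear_rzero)

lemma reflection_isometry: "B (reflection B \<alpha> x) (reflection B \<alpha> y) = B x y"
  by (cases "B \<alpha> \<alpha> = 0")
    (simp_all add: reflection_def coroot_def form_sym[of \<alpha> y] field_simps)

lemma reflection_involution: "reflection B \<alpha> (reflection B \<alpha> x) = x"
  by (cases "B \<alpha> \<alpha> = 0") (simp_all add: reflection_def coroot_def algebra_simps)

lemma reflection_linear:
  "reflection B \<alpha> (x - c *\<^sub>R y) = reflection B \<alpha> x - c *\<^sub>R reflection B \<alpha> y"
  by (simp add: reflection_def algebra_simps)

lemma reflection_conjugate:
  "reflection B (reflection B \<alpha> \<beta>) = reflection B \<alpha> \<circ> reflection B \<beta> \<circ> reflection B \<alpha>"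
proof
  fix x
  have "B (reflection B \<alpha> x) \<beta> = B x (reflection B \<alpha> \<beta>)"
    by (metis reflection_isometry reflection_involution)
  then have "reflection B \<beta> (reflection B \<alpha> x) =
      reflection B \<alpha> x - (2 / B \<beta> \<beta> * B x (reflection B \<alpha> \<beta>)) *\<^sub>R \<beta>"
    by (simp add: reflection_def[of B \<beta>] coroot_def)
  then have "reflection B \<alpha> (reflection B \<beta> (reflection B \<alpha> x)) =
      x - (2 / B \<beta> \<beta> * B x (reflection B \<alpha> \<beta>)) *\<^sub>R reflection B \<alpha> \<beta>"
    by (simp only: reflection_linear reflection_involution)
  also have "\<dots> = reflection B (reflection B \<alpha> \<beta>) x"
    unfolding reflection_def[of B "reflection B \<alpha> \<beta>"] coroot_def reflection_isometry by simp
  finally show "reflection B (reflection B \<alpha> \<beta>) x =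
      (reflection B \<alpha> \<circ> reflection B \<beta> \<circ> reflection B \<alpha>) x" by simp
qed

lemma reflection_in_group: "\<alpha> \<in> R \<Longrightarrow> reflection B \<alpha> \<in> reflection_group B R"
  using reflection_group.refl[OF _ reflection_group.id, of \<alpha> R B] by simp

lemma real_root_reflection:
  assumes "\<alpha> \<in> real_roots B \<Delta>"
  shows "reflection B \<alpha> \<in> reflection_group B \<Delta>"
proof -
  have "reflection B (w p) \<in> reflection_group B \<Delta>"
    if "w \<in> reflection_group B \<Delta>" "p \<in> \<Delta>" for w p
    using that
  proof (induction rule: reflection_group.induct)
    case id
    then show ?case by (simp add: reflection_in_group)
  next
    case (refl \<alpha> w)
    have "reflection B \<alpha> \<circ> reflection B (w p) \<circ> reflection B \<alpha> \<in> reflection_group B \<Delta>"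
      by (rule reflection_group_comp[OF reflection_group_comp])
        (use refl in \<open>simp_all add: reflection_in_group\<close>)
    then show ?case unfolding comp_apply[of "reflection B \<alpha>" w] reflection_conjugate .
  qed
  then show ?thesis using assms by (auto simp: real_roots_def)
qed

lemma reflection_group_real_roots: "weyl_group B \<Delta> = reflection_group B \<Delta>"
proof
  have "w \<in> reflection_group B \<Delta>" if "w \<in> reflection_group B (real_roots B \<Delta>)" for w
    using that by (induction rule: reflection_group.induct)
      (assumption | rule reflection_group.id reflection_group_comp real_root_reflection)+
  then show "weyl_group B \<Delta> \<subseteq> reflection_group B \<Delta>" by (auto simp: weyl_group_def)
  have "\<Delta> \<subseteq> real_roots B \<Delta>"
    using reflection_group.id[of B \<Delta>] unfolding real_roots_def
    by (metis (mono_tags, lifting) id_apply mem_Collect_eq subsetI)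
  then show "reflection_group B \<Delta> \<subseteq> weyl_group B \<Delta>"
    by (auto simp: weyl_group_def intro: reflection_group_mono)
qed

lemma real_roots_eq_orbits: "real_roots B \<Delta> = (\<Union>p\<in>\<Delta>. {w p | w. w \<in> weyl_group B \<Delta>})"
  by (auto simp: real_roots_def reflection_group_real_roots)

lemma independent_simple_coroots: "independent (coroot B ` \<Delta>)" "inj_on (coroot B) \<Delta>"
proof -
  have *: "\<forall>p\<in>\<Delta>. c p = 0" if "(\<Sum>p\<in>\<Delta>. c p *\<^sub>R coroot B p) = 0" for c
  proof -
    have "(\<Sum>p\<in>\<Delta>. (c p * (2 / B p p)) *\<^sub>R p) = 0" using that by (simp add: coroot_def)
    then have "\<forall>p\<in>\<Delta>. c p * (2 / B p p) = 0"
      using independent_simple dependent_finite[OF finite_simple] by meson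
    then show ?thesis using simple_pos by (metis divide_eq_0_iff less_irrefl mult_eq_0_iff zero_neq_numeral)
  qed
  show inj: "inj_on (coroot B) \<Delta>"
  proof (rule inj_onI, rule ccontr)
    fix p q assume pq: "p \<in> \<Delta>" "q \<in> \<Delta>" "coroot B p = coroot B q" "p \<noteq> q"
    let ?c = "\<lambda>x. if x = p then 1 else if x = q then -1 else (0::real)"
    have "(\<Sum>x\<in>\<Delta>. ?c x *\<^sub>R coroot B x) = (\<Sum>x\<in>{p, q}. ?c x *\<^sub>R coroot B x)"
      by (rule sum.mono_neutral_right) (use pq finite_simple in auto)
    also have "\<dots> = 0" using pq by simp
    finally have "?c p = 0" using *[of ?c] pq by blast
    then show False by simp
  qed
  have "\<forall>v\<in>coroot B ` \<Delta>. u v = 0" if "(\<Sum>v\<in>coroot B ` \<Delta>. u v *\<^sub>R v) = 0" for u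
    using that *[of "u \<circ> coroot B"] inj by (simp add: sum.reindex)
  then show "independent (coroot B ` \<Delta>)"
    using finite_simple by (auto simp: dependent_finite)
qed

lemma coroot_expansion:
  assumes "\<alpha> \<in> pos_roots B \<Delta>"
  shows "coroot B \<alpha> = (\<Sum>p\<in>\<Delta>. coroot_coeff B \<Delta> \<alpha> p *\<^sub>R coroot B p)"
proof -
  obtain c where c: "\<alpha> = (\<Sum>p\<in>\<Delta>. c p *\<^sub>R p)" using assms by (auto simp: pos_roots_def)
  have "p \<in> span (coroot B ` \<Delta>)" if "p \<in> \<Delta>" for p
  proof -
    have "p = (B p p / 2) *\<^sub>R coroot B p" using simple_pos[OF that] by (simp add: coroot_def)
    then show ?thesis by (metis imageI span_base span_scale that)
  qed
  then have "coroot B \<alpha> \<in> span (coroot B ` \<Delta>)"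
    unfolding coroot_def[of B \<alpha>] by (subst (2) c) (intro span_scale span_sum, auto)
  then have "(\<Sum>v\<in>coroot B ` \<Delta>. representation (coroot B ` \<Delta>) (coroot B \<alpha>) v *\<^sub>R v) = coroot B \<alpha>"
    using independent_simple_coroots(1) finite_simple by (intro real_vector.sum_representation_eq) auto
  then show ?thesis
    using independent_simple_coroots(2) by (simp add: sum.reindex coroot_coeff_def)
qed

end

end

theory Submission
  imports Defs
begin

text \<open>
  Fix \<open>i = (\<beta>, m)\<close> and put \<open>b = \<langle>\<lambda>, \<beta>\<^sup>\<or>\<rangle>\<close>. The vector
  \<open>x(u) = \<langle>\<lambda>, u\<rangle>/b (m, c(\<beta>\<^sup>\<or>)) - (0, c(u))\<close> is linear in \<open>u\<close>, and for a root
  \<open>\<alpha> \<noteq> \<plusminus>\<beta>\<close> the number \<open>N\<^sub>i(\<alpha>)\<close> is the least integer \<open>n\<close> with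
  \<open>(n, 0, \<dots>, 0) > x(\<alpha>\<^sup>\<or>)\<close> lexicographically. Since \<open>x(\<beta>\<^sup>\<or>) = (m, 0, \<dots>, 0)\<close>, adding
  \<open>k \<beta>\<^sup>\<or>\<close> shifts this integer by \<open>k m = k N\<^sub>i(\<beta>)\<close>. The convention
  \<open>N\<^sub>i(-\<alpha>) = 1 - N\<^sub>i(\<alpha>)\<close> is consistent with it because real roots are reduced, so that
  \<open>x(\<alpha>\<^sup>\<or>)\<close> is never an integer multiple of the first unit vector.
\<close>

section \<open>Lexicographic sign of a real family along a list\<close>

primrec lex_neg :: "'a list \<Rightarrow> ('a \<Rightarrow> real) \<Rightarrow> bool" where
  "lex_neg [] f \<longleftrightarrow> False"
| "lex_neg (p # ps) f \<longleftrightarrow> f p < 0 \<or> f p = 0 \<and> lex_neg ps f"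

text \<open>Passing to the sign of a difference makes the comparison amenable to linearity in the
  coroot.\<close>

lemma lexord_map_iff_lex_neg:
  "(map f ps, map g ps) \<in> lexord {(x, y). x < y} \<longleftrightarrow> lex_neg ps (\<lambda>p. f p - g p)"
  by (induction ps) auto

text \<open>The first nonzero entry decides both signs. The zero family has to be excluded, being
  negative in neither form.\<close>

lemma lex_neg_uminus:
  "\<exists>p\<in>set ps. f p \<noteq> 0 \<Longrightarrow> lex_neg ps (\<lambda>p. - f p) \<longleftrightarrow> \<not> lex_neg ps f"
  by (induction ps) auto

lemma lex_neg_mult:
  "0 < s \<Longrightarrow> lex_neg ps (\<lambda>p. s * f p) \<longleftrightarrow> lex_neg ps f"
  by (induction ps) (auto simp: mult_less_0_iff)

lemma not_lex_neg_nonneg: "(\<And>p. p \<in> set ps \<Longrightarrow> 0 \<le> f p) \<Longrightarrow> \<not> lex_neg ps f"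
  by (induction ps) (auto simp: not_less)

lemma lex_neg_cong: "(\<And>p. p \<in> set ps \<Longrightarrow> f p = g p) \<Longrightarrow> lex_neg ps f \<longleftrightarrow> lex_neg ps g"
  by (induction ps) auto

section \<open>Basis coordinates and integral spans\<close>

lemma representation_sum_scaleR:
  fixes f :: "'a \<Rightarrow> 'v::real_vector"
  assumes "finite A" "inj_on f A" "independent (f ` A)" "p \<in> A"
  shows "representation (f ` A) (\<Sum>q\<in>A. z q *\<^sub>R f q) (f p) = z p"
proof -
  have "representation (f ` A) (\<Sum>q\<in>A. z q *\<^sub>R f q) (f p) =
      (\<Sum>q\<in>A. representation (f ` A) (z q *\<^sub>R f q) (f p))"
    using assms by (subst real_vector.representation_sum) (auto intro: span_base span_scale)
  also have "\<dots> = (\<Sum>q\<in>A. if q = p then z q else 0)"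
    using assms by (intro sum.cong refl)
      (auto simp: real_vector.representation_scale real_vector.representation_basis span_base inj_on_eq_iff)
  also have "\<dots> = z p" using assms by simp
  finally show ?thesis .
qed

text \<open>Over \<open>\<Delta>\<close> this is the root lattice when \<open>f\<close> is the
  identity and the coroot lattice when \<open>f\<close> is \<open>coroot B\<close>.\<close>

definition int_span :: "('a \<Rightarrow> 'v::real_vector) \<Rightarrow> 'a set \<Rightarrow> 'v set" where
  "int_span f A = {\<Sum>p\<in>A. of_int (z p) *\<^sub>R f p | z. True}"

lemma int_span_base:
  assumes "finite A" "p \<in> A" shows "f p \<in> int_span f A"
proof -
  have "(\<Sum>q\<in>A. of_int (if q = p then 1 else 0) *\<^sub>R f q) = (\<Sum>q\<in>A. if q = p then f q else 0)"
    by (rule sum.cong) auto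
  also have "\<dots> = f p" using assms by simp
  finally show ?thesis unfolding int_span_def mem_Collect_eq
    by (intro exI[of _ "\<lambda>q. if q = p then 1 else 0"]) simp
qed

lemma int_span_diff_scale:
  assumes "finite A" "x \<in> int_span f A" "p \<in> A" "c \<in> \<int>"
  shows "x - c *\<^sub>R f p \<in> int_span f A"
proof -
  obtain z where z: "x = (\<Sum>q\<in>A. of_int (z q) *\<^sub>R f q)" using assms by (auto simp: int_span_def)
  obtain n where n: "c = of_int n" using assms by (auto elim: Ints_cases)
  have "(\<Sum>q\<in>A. of_int (z q - (if q = p then n else 0)) *\<^sub>R f q) =
      (\<Sum>q\<in>A. of_int (z q) *\<^sub>R f q - (if q = p then c *\<^sub>R f q else 0))"
    by (rule sum.cong) (auto simp: n scaleR_left_diff_distrib)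
  also have "\<dots> = x - c *\<^sub>R f p" using assms by (simp add: sum_subtractf z)
  finally show ?thesis unfolding int_span_def mem_Collect_eq
    by (intro exI[of _ "\<lambda>q. z q - (if q = p then n else 0)"]) simp
qed

lemma int_span_subset_span: "int_span f A \<subseteq> span (f ` A)"
  by (auto simp: int_span_def intro: span_sum span_scale span_base)

lemma representation_int_span:
  fixes f :: "'a \<Rightarrow> 'v::real_vector"
  assumes "finite A" "inj_on f A" "independent (f ` A)" "p \<in> A" "x \<in> int_span f A"
  shows "representation (f ` A) x (f p) \<in> \<int>"
proof -
  obtain z where "x = (\<Sum>p\<in>A. of_int (z p) *\<^sub>R f p)" using assms(5) by (auto simp: int_span_def)
  then show ?thesis using representation_sum_scaleR[OF assms(1-4), of "\<lambda>q. of_int (z q)"] by simp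
qed

section \<open>Root and coroot lattices, and reducedness of the real roots\<close>

context kac_moody_roots
begin

lemma form_sum: "B (\<Sum>p\<in>A. g p) x = (\<Sum>p\<in>A. B (g p) x)" "B x (\<Sum>p\<in>A. g p) = (\<Sum>p\<in>A. B x (g p))"
  by (induction A rule: infinite_finite_induct) auto

lemma form_uminus: "B (- x) y = - B x y" "B x (- y) = - B x y"
  using form_simps(5)[of "-1" x y] form_simps(6)[of x "-1" y] by simp_all

lemma coroot_scale: "coroot B (t *\<^sub>R \<alpha>) = (1 / t) *\<^sub>R coroot B \<alpha>"
  by (cases "t = 0") (simp_all add: coroot_def)

lemma coroot_uminus: "coroot B (- \<alpha>) = - coroot B \<alpha>"
  using coroot_scale[of "-1" \<alpha>] by simp

lemma cartan_int': assumes "p \<in> \<Delta>" "q \<in> \<Delta>" shows "B p (coroot B q) \<in> \<int>"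
  using cartan_int[OF assms] simple_pos[OF assms(1)] by (cases "p = q") (auto simp: coroot_def)

lemma form_int_span:
  assumes "x \<in> int_span f A" "\<And>p. p \<in> A \<Longrightarrow> B (f p) y \<in> \<int>" shows "B x y \<in> \<int>"
  using assms by (auto simp: int_span_def form_sum intro!: Ints_sum Ints_mult)

lemma real_root_cases:
  assumes "\<alpha> \<in> real_roots B \<Delta>"
  obtains w p where "\<alpha> = w p" "w \<in> reflection_group B \<Delta>" "p \<in> \<Delta>"
  using assms by (auto simp: real_roots_def)

lemma real_root_norm_pos: assumes "\<alpha> \<in> real_roots B \<Delta>" shows "B \<alpha> \<alpha> > 0"
proof -
  have "B (w p) (w p) > 0" if "w \<in> reflection_group B \<Delta>" "p \<in> \<Delta>" for w p
    using that by (induction rule: reflection_group.induct) (auto simp: simple_pos reflection_isometry)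
  then show ?thesis using assms by (auto elim: real_root_cases)
qed

text \<open>By induction on the word \<open>w\<close>: a simple reflection changes a root or coroot
  by a multiple of the simple root or coroot, and the multiplier is an integer combination of Cartan
  integers.\<close>

lemma real_root_int_span:
  assumes "\<alpha> \<in> real_roots B \<Delta>"
  shows "\<alpha> \<in> int_span (\<lambda>p. p) \<Delta>" "coroot B \<alpha> \<in> int_span (coroot B) \<Delta>"
proof -
  have "w p \<in> int_span (\<lambda>p. p) \<Delta> \<and> coroot B (w p) \<in> int_span (coroot B) \<Delta>"
    if "w \<in> reflection_group B \<Delta>" "p \<in> \<Delta>" for w p
    using that
  proof (induction rule: reflection_group.induct)
    case id
    then show ?case
      using int_span_base[OF finite_simple, of p "\<lambda>p. p"] int_span_base[OF finite_simple, of p "coroot B"]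
      by simp
  next
    case (refl q w)
    let ?x = "w p"
    have 1: "reflection B q ?x \<in> int_span (\<lambda>p. p) \<Delta>"
      unfolding reflection_def
      by (rule int_span_diff_scale[OF finite_simple])
        (use refl in \<open>auto intro: form_int_span cartan_int'\<close>)
    have "B (coroot B ?x) q \<in> \<int>"
      by (rule form_int_span[of _ "coroot B" \<Delta>])
        (use refl in \<open>auto simp: form_sym[of _ q] intro: cartan_int'\<close>)
    then have "coroot B ?x - B (coroot B ?x) q *\<^sub>R coroot B q \<in> int_span (coroot B) \<Delta>"
      by (intro int_span_diff_scale[OF finite_simple]) (use refl in auto)
    \<comment> \<open>The coroot of a reflected root is the reflected coroot, because the reflection
      preserves norms.\<close>
    also have "coroot B ?x - B (coroot B ?x) q *\<^sub>R coroot B q = coroot B (reflection B q ?x)"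
      unfolding coroot_def[of B "reflection B q ?x"] reflection_isometry
      by (simp add: coroot_def reflection_def algebra_simps)
    finally show ?case using 1 by simp
  qed
  then show "\<alpha> \<in> int_span (\<lambda>p. p) \<Delta>" "coroot B \<alpha> \<in> int_span (coroot B) \<Delta>"
    using assms by (auto elim!: real_root_cases)
qed

lemma reflection_group_scale:
  assumes "w \<in> reflection_group B \<Delta>" shows "w (c *\<^sub>R x) = c *\<^sub>R w x"
  using assms by (induction rule: reflection_group.induct) (auto simp: reflection_def algebra_simps)

text \<open>Reversing the word inverts it, since each reflection is an involution.\<close>

lemma reflection_group_left_inverse:
  assumes "w \<in> reflection_group B \<Delta>"
  shows "\<exists>w'\<in>reflection_group B \<Delta>. \<forall>x. w' (w x) = x"
  using assms
proof (induction rule: reflection_group.induct)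
  case id
  show ?case by (rule bexI[OF _ reflection_group.id]) simp
next
  case (refl q w)
  then obtain w' where "w' \<in> reflection_group B \<Delta>" "\<forall>x. w' (w x) = x" by blast
  then show ?case using refl
    by (intro bexI[of _ "w' \<circ> reflection B q"])
      (auto simp: reflection_involution intro: reflection_group_comp reflection_in_group)
qed

text \<open>The root lattice forces \<open>t\<close> to be an integer. The coroot of
  \<open>t *\<^sub>R p\<close> is \<open>1 / t\<close> times that of \<open>p\<close>, so the coroot
  lattice forces \<open>1 / t\<close> to be an integer as well.\<close>

lemma multiple_simple_real_root:
  assumes "t *\<^sub>R p \<in> real_roots B \<Delta>" "p \<in> \<Delta>"
  shows "\<bar>t\<bar> = 1"
proof -
  have t: "t \<noteq> 0" using real_root_norm_pos[OF assms(1)] by auto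
  have "representation \<Delta> (t *\<^sub>R p) p \<in> \<int>"
    using representation_int_span[of \<Delta> "\<lambda>p. p" p, OF finite_simple _ _ assms(2)
        real_root_int_span(1)[OF assms(1)]] independent_simple by simp
  then have 1: "t \<in> \<int>" using independent_simple assms(2)
    by (simp add: real_vector.representation_scale real_vector.representation_basis span_base)
  have "representation (coroot B ` \<Delta>) (coroot B (t *\<^sub>R p)) (coroot B p) \<in> \<int>"
    by (rule representation_int_span[OF finite_simple _ _ assms(2) real_root_int_span(2)[OF assms(1)]])
      (rule independent_simple_coroots)+
  then have "1 / t \<in> \<int>"
    using independent_simple_coroots(1) assms(2) unfolding coroot_scale
    by (simp add: real_vector.representation_scale real_vector.representation_basis span_base)
  then obtain a b where "t = of_int a" "1 / t = of_int b" using 1 by (metis Ints_cases)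
  then have "of_int (a * b) = (1::real)" using t
    by (metis nonzero_mult_div_cancel_left of_int_mult times_divide_eq_right mult.right_neutral)
  then have "a * b = 1" by linarith
  then have "\<bar>a\<bar> = 1" by (metis dvd_triv_left zdvd1_eq)
  then show ?thesis using \<open>t = of_int a\<close> by linarith
qed

text \<open>Undoing \<open>w\<close> moves the line through \<open>\<alpha>\<close> to the line
  through a simple root.\<close>

lemma real_roots_reduced:
  assumes "\<alpha> \<in> real_roots B \<Delta>" "t *\<^sub>R \<alpha> \<in> real_roots B \<Delta>"
  shows "\<bar>t\<bar> = 1"
proof -
  obtain w p where w: "\<alpha> = w p" "w \<in> reflection_group B \<Delta>" "p \<in> \<Delta>"
    using assms(1) by (rule real_root_cases)
  obtain w' where w': "w' \<in> reflection_group B \<Delta>" "\<forall>x. w' (w x) = x"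
    using reflection_group_left_inverse w(2) by blast
  obtain u q where u: "t *\<^sub>R \<alpha> = u q" "u \<in> reflection_group B \<Delta>" "q \<in> \<Delta>"
    using assms(2) by (rule real_root_cases)
  have "t *\<^sub>R p = (w' \<circ> u) q"
    by (simp flip: u(1) add: w w'(2) reflection_group_scale[OF w'(1)])
  moreover have "w' \<circ> u \<in> reflection_group B \<Delta>" using w' u by (intro reflection_group_comp)
  ultimately have "t *\<^sub>R p \<in> real_roots B \<Delta>" using u(3) unfolding real_roots_def by blast
  then show ?thesis using multiple_simple_real_root w(3) by blast
qed

text \<open>Proportional coroots come from proportional roots; reducedness then makes the lengths
  equal, so that roots and coroots share the same factor.\<close>

lemma coroot_proportional:
  assumes "\<alpha> \<in> real_roots B \<Delta>" "\<beta> \<in> real_roots B \<Delta>" "coroot B \<alpha> = s *\<^sub>R coroot B \<beta>"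
  shows "\<alpha> = s *\<^sub>R \<beta>" "\<bar>s\<bar> = 1" "\<alpha> = \<beta> \<or> \<alpha> = - \<beta>"
proof -
  note pos = real_root_norm_pos[OF assms(1)] real_root_norm_pos[OF assms(2)]
  define t where "t = s * B \<alpha> \<alpha> / B \<beta> \<beta>"
  have "\<alpha> = (B \<alpha> \<alpha> / 2) *\<^sub>R coroot B \<alpha>" using pos by (simp add: coroot_def)
  also have "\<dots> = t *\<^sub>R \<beta>" unfolding assms(3) by (simp add: coroot_def t_def)
  finally have t: "\<alpha> = t *\<^sub>R \<beta>" .
  then have "\<bar>t\<bar> = 1" using assms real_roots_reduced by metis
  then have "t = 1 \<or> t = -1" by linarith
  then have "B \<alpha> \<alpha> = B \<beta> \<beta>" using t by (auto simp: form_uminus)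
  then have "t = s" unfolding t_def using pos by simp
  then show "\<alpha> = s *\<^sub>R \<beta>" "\<bar>s\<bar> = 1" "\<alpha> = \<beta> \<or> \<alpha> = - \<beta>"
    using t \<open>\<bar>t\<bar> = 1\<close> \<open>t = 1 \<or> t = -1\<close> by auto
qed

section \<open>Signs and integrality of coroot coordinates\<close>

lemma pos_root_real: "\<alpha> \<in> pos_roots B \<Delta> \<Longrightarrow> \<alpha> \<in> real_roots B \<Delta>"
  by (simp add: pos_roots_def)

text \<open>Rewriting simple roots as simple coroots multiplies the root coefficients by the
  positive ratios \<open>B p p / B \<alpha> \<alpha>\<close>.\<close>

lemma pos_root_coeff_nonneg:
  assumes "\<alpha> \<in> pos_roots B \<Delta>" "p \<in> \<Delta>"
  shows "coroot_coeff B \<Delta> \<alpha> p \<ge> 0"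
proof -
  obtain c where c: "\<forall>p\<in>\<Delta>. 0 \<le> c p" "\<alpha> = (\<Sum>p\<in>\<Delta>. c p *\<^sub>R p)"
    using assms by (auto simp: pos_roots_def)
  have pos: "B \<alpha> \<alpha> > 0" using assms pos_root_real real_root_norm_pos by blast
  have "coroot B \<alpha> = (\<Sum>p\<in>\<Delta>. (2 / B \<alpha> \<alpha> * c p) *\<^sub>R p)"
    unfolding coroot_def[of B \<alpha>] by (subst (2) c(2)) (simp add: scaleR_sum_right)
  also have "\<dots> = (\<Sum>p\<in>\<Delta>. (c p * B p p / B \<alpha> \<alpha>) *\<^sub>R coroot B p)"
    by (intro sum.cong refl) (auto simp: coroot_def dest: simple_pos)
  finally have "coroot_coeff B \<Delta> \<alpha> p = c p * B p p / B \<alpha> \<alpha>"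
    unfolding coroot_coeff_def
    using representation_sum_scaleR[OF finite_simple independent_simple_coroots(2,1) assms(2)] by simp
  then show ?thesis using c(1) assms(2) pos simple_pos[OF assms(2)] by simp
qed

lemma coroot_in_span:
  assumes "\<alpha> \<in> real_roots B \<Delta>" shows "coroot B \<alpha> \<in> span (coroot B ` \<Delta>)"
  by (rule subsetD[OF int_span_subset_span real_root_int_span(2)[OF assms]])

lemma coroot_coeff_uminus:
  assumes "\<alpha> \<in> real_roots B \<Delta>" shows "coroot_coeff B \<Delta> (- \<alpha>) p = - coroot_coeff B \<Delta> \<alpha> p"
  unfolding coroot_coeff_def coroot_uminus
  by (simp add: real_vector.representation_neg[OF independent_simple_coroots(1) coroot_in_span[OF assms]])

lemma coroot_coeff_add:
  assumes "\<alpha> \<in> real_roots B \<Delta>" "\<beta> \<in> real_roots B \<Delta>" "coroot B \<gamma> = coroot B \<alpha> + c *\<^sub>R coroot B \<beta>"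
  shows "coroot_coeff B \<Delta> \<gamma> p = coroot_coeff B \<Delta> \<alpha> p + c * coroot_coeff B \<Delta> \<beta> p"
  unfolding coroot_coeff_def assms(3)
  by (simp add: real_vector.representation_add real_vector.representation_scale
      independent_simple_coroots span_scale coroot_in_span assms(1,2))

lemma uminus_pos_root_not_pos:
  assumes "\<alpha> \<in> pos_roots B \<Delta>" shows "- \<alpha> \<notin> pos_roots B \<Delta>"
proof
  assume neg: "- \<alpha> \<in> pos_roots B \<Delta>"
  have "coroot_coeff B \<Delta> \<alpha> p = 0" if "p \<in> \<Delta>" for p
    using coroot_coeff_uminus[OF pos_root_real[OF assms], of p]
      pos_root_coeff_nonneg[OF neg that] pos_root_coeff_nonneg[OF assms that] by linarith
  then have "coroot B \<alpha> = 0" using coroot_expansion[OF assms] by simp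
  then show False using real_root_norm_pos[OF pos_root_real[OF assms]] by (auto simp: coroot_def)
qed

lemma real_root_not_pos:
  "\<alpha> \<in> real_roots B \<Delta> \<Longrightarrow> \<alpha> \<notin> pos_roots B \<Delta> \<Longrightarrow> - \<alpha> \<in> pos_roots B \<Delta>"
  using sign_coherent by auto

text \<open>Integrality is prescribed on simple coroots and spreads over the coroot lattice.\<close>

lemma weight_coroot_int:
  assumes "lam \<in> integral_weights B \<Delta>" "\<alpha> \<in> real_roots B \<Delta>"
  shows "B lam (coroot B \<alpha>) \<in> \<int>"
  unfolding form_sym[of lam]
  by (rule form_int_span[OF real_root_int_span(2)[OF assms(2)]])
    (use assms(1) in \<open>auto simp: integral_weights_def form_sym[of lam]\<close>)

lemma coroot_coeff_int:
  "\<alpha> \<in> real_roots B \<Delta> \<Longrightarrow> p \<in> \<Delta> \<Longrightarrow> coroot_coeff B \<Delta> \<alpha> p \<in> \<int>"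
  unfolding coroot_coeff_def
  by (rule representation_int_span[OF finite_simple])
    (auto simp: independent_simple_coroots real_root_int_span)

lemma coroot_eq_scaleRI:
  assumes "\<alpha> \<in> real_roots B \<Delta>" "\<beta> \<in> real_roots B \<Delta>"
    and "\<And>p. p \<in> \<Delta> \<Longrightarrow> coroot_coeff B \<Delta> \<alpha> p = s * coroot_coeff B \<Delta> \<beta> p"
  shows "coroot B \<alpha> = s *\<^sub>R coroot B \<beta>"
proof -
  \<comment> \<open>The expansion in simple coroots is needed for negative roots too, where
    \<open>coroot_expansion\<close> does not apply.\<close>
  have exp: "coroot B \<alpha> = (\<Sum>p\<in>\<Delta>. coroot_coeff B \<Delta> \<alpha> p *\<^sub>R coroot B p)"
    if \<alpha>: "\<alpha> \<in> real_roots B \<Delta>" for \<alpha>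
  proof -
    obtain z where z: "coroot B \<alpha> = (\<Sum>p\<in>\<Delta>. of_int (z p) *\<^sub>R coroot B p)"
      using real_root_int_span(2)[OF \<alpha>] by (auto simp: int_span_def)
    then have "coroot_coeff B \<Delta> \<alpha> p = of_int (z p)" if "p \<in> \<Delta>" for p
      unfolding coroot_coeff_def
      using representation_sum_scaleR[OF finite_simple independent_simple_coroots(2,1) that] by simp
    then show ?thesis using z by simp
  qed
  show ?thesis
    unfolding exp[OF assms(1)] exp[OF assms(2)] using assms(3) by (simp add: scaleR_sum_right)
qed

end

section \<open>The index set and its total order\<close>

locale chain_setup = kac_moody_roots B \<Delta>
  for B :: "'v::real_vector \<Rightarrow> 'v \<Rightarrow> real" and \<Delta> +
  fixes ps :: "'v list" and lam :: 'v
  assumes integral: "lam \<in> integral_weights B \<Delta>"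
    and dom: "dominant B \<Delta> lam"
    and set_ps: "set ps = \<Delta>"
begin

abbreviation "I \<equiv> chain_index B \<Delta> lam"
abbreviation "cvec \<equiv> chain_vec B \<Delta> ps lam"
abbreviation "lt \<equiv> chain_less B \<Delta> ps lam"
abbreviation "ht \<alpha> \<equiv> B lam (coroot B \<alpha>)"

lemma ht_uminus: "ht (- \<alpha>) = - ht \<alpha>"
  by (simp add: coroot_uminus form_uminus)

lemma chain_vec_in_Rats:
  assumes "i \<in> I" shows "set (cvec i) \<subseteq> \<rat>"
proof -
  obtain \<alpha> k where i: "i = (\<alpha>, k)" "\<alpha> \<in> real_roots B \<Delta>"
    using assms by (auto simp: chain_index_def pos_root_real)
  have Q: "x \<in> \<rat>" if "x \<in> \<int>" for x :: real using that Ints_subset_Rats by blast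
  show ?thesis using Q[OF weight_coroot_int[OF integral i(2)]] Q[OF coroot_coeff_int[OF i(2)]] set_ps
    by (auto simp: i(1) chain_vec_def intro!: Rats_divide)
qed

text \<open>Equal tails make the two coroots proportional, so reducedness identifies the roots; the
  first entries then identify the integers.\<close>

lemma chain_vec_inj: "inj_on cvec I"
proof (rule inj_onI)
  fix i j assume ij: "i \<in> I" "j \<in> I" "cvec i = cvec j"
  obtain \<alpha> k \<beta> m where eq: "i = (\<alpha>, k)" "j = (\<beta>, m)" by (metis surj_pair)
  have pos: "\<alpha> \<in> pos_roots B \<Delta>" "\<beta> \<in> pos_roots B \<Delta>" "ht \<alpha> > 0" "ht \<beta> > 0"
    using ij(1,2) by (auto simp: eq chain_index_def)
  have c: "coroot_coeff B \<Delta> \<alpha> p / ht \<alpha> = coroot_coeff B \<Delta> \<beta> p / ht \<beta>" if "p \<in> \<Delta>" for p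
    using ij(3) that by (auto simp: eq chain_vec_def set_ps)
  have k: "of_int k / ht \<alpha> = of_int m / ht \<beta>"
    using ij(3) by (auto simp: eq chain_vec_def)
  have "coroot B \<alpha> = (ht \<alpha> / ht \<beta>) *\<^sub>R coroot B \<beta>"
    using c pos by (intro coroot_eq_scaleRI) (auto simp: pos_root_real field_simps)
  \<comment> \<open>The factor has absolute value 1 and is a quotient of positive heights, hence
    equals 1. This rules out opposite roots.\<close>
  from coroot_proportional[OF pos_root_real pos_root_real this] pos
  have "\<alpha> = \<beta>" by simp
  with k pos show "i = j" by (simp add: eq)
qed

text \<open>The lexicographic order is pulled back along \<open>cvec\<close>; totality rests on
  injectivity.\<close>

lemma chain_less_strict_linear: "strict_linear_order_on I lt"
  unfolding strict_linear_order_on_def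
proof (intro conjI)
  have "trans (lexord {(x::real, y). x < y})"
    by (rule lexord_transI) (auto simp: trans_def)
  then show "trans lt" unfolding chain_less_def by (blast intro: transI dest: transD)
  have "(x, x) \<notin> lexord {(x::real, y). x < y}" for x by (rule lexord_irreflexive) auto
  then show "irrefl lt" by (auto simp: chain_less_def irrefl_def)
  have linear: "(x, y) \<in> lexord {(x::real, y). x < y} \<or> x = y \<or> (y, x) \<in> lexord {(x::real, y). x < y}" for x y
    by (rule lexord_linear) auto
  show "total_on I lt"
  proof (rule total_onI)
    fix i j assume "i \<in> I" "j \<in> I" "i \<noteq> j"
    then show "(i, j) \<in> lt \<or> (j, i) \<in> lt"
      using linear[of "cvec i" "cvec j"] inj_onD[OF chain_vec_inj, of i j] by (simp add: chain_less_def) blast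
  qed
qed

lemma chain_index_fiber:
  assumes "\<alpha> \<in> pos_roots B \<Delta>"
  shows "finite {i \<in> I. fst i = \<alpha>}" "real (card {i \<in> I. fst i = \<alpha>}) = ht \<alpha>"
proof -
  obtain n where n: "ht \<alpha> = of_int n"
    using weight_coroot_int[OF integral pos_root_real[OF assms]] by (auto elim: Ints_cases)
  \<comment> \<open>Dominance is essential: for negative \<open>n\<close> the fibre would be empty,
    with cardinality 0 instead of \<open>n\<close>.\<close>
  have "n \<ge> 0" using dom assms n by (auto simp: dominant_def)
  have eq: "{i \<in> I. fst i = \<alpha>} = Pair \<alpha> ` {0..<n}"
    using assms n by (auto simp: chain_index_def)
  show "finite {i \<in> I. fst i = \<alpha>}" "real (card {i \<in> I. fst i = \<alpha>}) = ht \<alpha>"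
    unfolding eq using \<open>n \<ge> 0\<close> n by (auto simp: card_image inj_on_def)
qed

section \<open>Counting the indices below a fixed one\<close>

text \<open>Minus the tail of \<open>x(\<alpha>\<^sup>\<or>)\<close>. It depends linearly on the
  coroot of \<open>\<alpha>\<close> and vanishes at \<open>\<alpha> = \<beta>\<close> when
  \<open>ht \<beta>\<close> is nonzero; its sign breaks ties in the first entry.\<close>

definition offset :: "'v \<Rightarrow> 'v \<Rightarrow> 'v \<Rightarrow> real" where
  "offset \<beta> \<alpha> p = coroot_coeff B \<Delta> \<alpha> p - ht \<alpha> / ht \<beta> * coroot_coeff B \<Delta> \<beta> p"

text \<open>The least integer \<open>n\<close> with \<open>(n, 0, \<dots>, 0) > (ht \<alpha> m / ht \<beta>, - offset \<beta> \<alpha>)\<close>, provided that the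
  right-hand side is not itself of the form \<open>(n, 0, \<dots>, 0)\<close>.\<close>
definition lex_ceiling :: "'v \<Rightarrow> int \<Rightarrow> 'v \<Rightarrow> int" where
  "lex_ceiling \<beta> m \<alpha> = \<lceil>ht \<alpha> * of_int m / ht \<beta>\<rceil> +
     of_bool (ht \<alpha> * of_int m / ht \<beta> \<in> \<int> \<and> lex_neg ps (offset \<beta> \<alpha>))"

text \<open>Away from integers, negation turns a ceiling \<open>c\<close> into \<open>1 - c\<close>
  and no tie occurs. At an integer the ceilings cancel, and exactly one of the two tie terms
  contributes 1.\<close>

lemma lex_ceiling_uminus:
  assumes "\<alpha> \<in> real_roots B \<Delta>" "\<beta> \<in> real_roots B \<Delta>" "\<alpha> \<noteq> \<beta>" "\<alpha> \<noteq> - \<beta>"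
  shows "lex_ceiling \<beta> m (- \<alpha>) = 1 - lex_ceiling \<beta> m \<alpha>"
proof -
  let ?x = "ht \<alpha> * of_int m / ht \<beta>"
  \<comment> \<open>A vanishing offset would make the coroots proportional, hence the roots equal or
    opposite.\<close>
  have "\<exists>p\<in>set ps. offset \<beta> \<alpha> p \<noteq> 0"
  proof (rule ccontr)
    assume "\<not> ?thesis"
    then have "coroot B \<alpha> = (ht \<alpha> / ht \<beta>) *\<^sub>R coroot B \<beta>"
      using assms by (intro coroot_eq_scaleRI) (auto simp: offset_def set_ps)
    from coroot_proportional(3)[OF assms(1,2) this] assms(3,4) show False by blast
  qed
  moreover have "offset \<beta> (- \<alpha>) = (\<lambda>p. - offset \<beta> \<alpha> p)"
    by (auto simp: offset_def ht_uminus coroot_coeff_uminus[OF assms(1)])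
  ultimately have "lex_neg ps (offset \<beta> (- \<alpha>)) \<longleftrightarrow> \<not> lex_neg ps (offset \<beta> \<alpha>)"
    by (simp add: lex_neg_uminus)
  moreover have "\<lceil>- ?x\<rceil> = (if ?x \<in> \<int> then - \<lceil>?x\<rceil> else 1 - \<lceil>?x\<rceil>)"
  proof (cases "?x \<in> \<int>")
    case True
    then obtain z where "?x = of_int z" by (rule Ints_cases)
    then show ?thesis by (simp add: ceiling_minus)
  next
    case False
    then have "of_int \<lfloor>?x\<rfloor> \<noteq> ?x" by (metis Ints_of_int)
    then show ?thesis using False unfolding ceiling_minus by (simp add: ceiling_altdef)
  qed
  moreover have "- ?x \<in> \<int> \<longleftrightarrow> ?x \<in> \<int>" by simp
  ultimately show ?thesis by (auto simp: lex_ceiling_def ht_uminus)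
qed

text \<open>The offset is unchanged, and the argument of the ceiling moves by the integer
  \<open>k * m\<close>, so the tie condition is unchanged as well.\<close>

lemma lex_ceiling_add:
  assumes "\<alpha> \<in> real_roots B \<Delta>" "\<beta> \<in> real_roots B \<Delta>" "ht \<beta> > 0"
    and eq: "coroot B \<gamma> = coroot B \<alpha> + of_int k *\<^sub>R coroot B \<beta>"
  shows "lex_ceiling \<beta> m \<gamma> = lex_ceiling \<beta> m \<alpha> + k * m"
proof -
  have ht: "ht \<gamma> = ht \<alpha> + of_int k * ht \<beta>" by (simp add: eq)
  have "offset \<beta> \<gamma> = offset \<beta> \<alpha>"
    using assms(3) by (auto simp: offset_def ht coroot_coeff_add[OF assms(1,2) eq] field_simps)
  moreover have x: "ht \<gamma> * of_int m / ht \<beta> = ht \<alpha> * of_int m / ht \<beta> + of_int (k * m)"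
    using assms(3) by (simp add: ht field_simps)
  moreover have "\<lceil>ht \<alpha> * of_int m / ht \<beta> + of_int (k * m)\<rceil> = \<lceil>ht \<alpha> * of_int m / ht \<beta>\<rceil> + k * m"
    by (rule ceiling_add_of_int)
  moreover have "y + of_int (k * m) \<in> \<int> \<longleftrightarrow> y \<in> \<int>" for y :: real
    by (metis Ints_add Ints_diff Ints_of_int add_diff_cancel_right')
  ultimately show ?thesis by (simp only: lex_ceiling_def)
qed

lemma card_below_pos:
  assumes \<alpha>: "\<alpha> \<in> pos_roots B \<Delta>" and i: "(\<beta>, m) \<in> I" and ne: "\<alpha> \<noteq> \<beta>"
  shows "int (card {j \<in> I. (j, (\<beta>, m)) \<in> lt \<and> fst j = \<alpha>}) = lex_ceiling \<beta> m \<alpha>"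
proof -
  have \<beta>: "ht \<beta> > 0" "0 \<le> m" "of_int m < ht \<beta>" using i by (auto simp: chain_index_def)
  obtain n where n: "ht \<alpha> = of_int n"
    using weight_coroot_int[OF integral pos_root_real[OF \<alpha>]] by (auto elim: Ints_cases)
  have "n \<ge> 0" using dom \<alpha> n by (auto simp: dominant_def)
  let ?x = "of_int n * of_int m / ht \<beta>"
  let ?N = "lex_ceiling \<beta> m \<alpha>"
  show ?thesis
  proof (cases "n = 0")
    case True
    \<comment> \<open>At height 0 no index carries \<open>\<alpha>\<close>. The offset is then just
      the coroot coordinates of \<open>\<alpha>\<close>, which are nonnegative, so the tie term is
      0.\<close>
    have "{j \<in> I. (j, (\<beta>, m)) \<in> lt \<and> fst j = \<alpha>} = {}"
      using n True by (auto simp: chain_index_def)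
    moreover have "\<not> lex_neg ps (offset \<beta> \<alpha>)"
      by (rule not_lex_neg_nonneg)
        (use n True pos_root_coeff_nonneg[OF \<alpha>] in \<open>auto simp: offset_def set_ps\<close>)
    then have "?N = 0" using n True by (simp add: lex_ceiling_def)
    ultimately show ?thesis by (simp only: card.empty of_nat_0)
  next
    case False
    then have n0: "n > 0" using \<open>n \<ge> 0\<close> by simp
    \<comment> \<open>This strict bound comes from \<open>m < ht \<beta>\<close>. When
      \<open>?x\<close> is an integer it leaves room for the extra 1 of the tie term, giving
      \<open>?N \<le> n\<close>.\<close>
    have "?x < of_int n" using \<beta> n0 by (simp add: field_simps)
    then have up: "\<lceil>?x\<rceil> \<le> n" and "?x \<in> \<int> \<Longrightarrow> \<lceil>?x\<rceil> < n"
      by (simp_all add: ceiling_le_iff) (metis Ints_cases ceiling_of_int of_int_less_iff)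
    then have Nn: "?N \<le> n" by (auto simp: lex_ceiling_def n)
    have "?x \<ge> 0" using \<beta> n0 by simp
    then have N0: "?N \<ge> 0" by (simp add: lex_ceiling_def n order_less_le_trans[of "-1" 0])
    have less: "((\<alpha>, j), (\<beta>, m)) \<in> lt \<longleftrightarrow> j < ?N" if "(\<alpha>, j) \<in> I" for j
    proof -
      have "((\<alpha>, j), (\<beta>, m)) \<in> lt \<longleftrightarrow> of_int j / of_int n < of_int m / ht \<beta> \<or>
          of_int j / of_int n = of_int m / ht \<beta> \<and>
          lex_neg ps (\<lambda>p. coroot_coeff B \<Delta> \<alpha> p / of_int n - coroot_coeff B \<Delta> \<beta> p / ht \<beta>)"
        using i that unfolding chain_less_def chain_vec_def
        by (simp add: n comp_def lexord_map_iff_lex_neg[symmetric])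
      \<comment> \<open>Scaling by the positive height \<open>n\<close> of \<open>\<alpha>\<close>
        turns the difference of tails into \<open>offset\<close>.\<close>
      also have "lex_neg ps (\<lambda>p. coroot_coeff B \<Delta> \<alpha> p / of_int n - coroot_coeff B \<Delta> \<beta> p / ht \<beta>) \<longleftrightarrow>
          lex_neg ps (\<lambda>p. of_int n * (coroot_coeff B \<Delta> \<alpha> p / of_int n - coroot_coeff B \<Delta> \<beta> p / ht \<beta>))"
        using n0 by (simp only: lex_neg_mult of_int_0_less_iff)
      also have "\<dots> \<longleftrightarrow> lex_neg ps (offset \<beta> \<alpha>)"
        using n0 by (intro lex_neg_cong) (simp add: offset_def n field_simps)
      also have "of_int j / of_int n < of_int m / ht \<beta> \<longleftrightarrow> of_int j < ?x"
        using n0 \<beta>(1) by (simp add: field_simps)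
      also have "of_int j / of_int n = of_int m / ht \<beta> \<longleftrightarrow> of_int j = ?x"
        using n0 \<beta>(1) by (simp add: field_simps)
      also have "of_int j < ?x \<or> of_int j = ?x \<and> lex_neg ps (offset \<beta> \<alpha>) \<longleftrightarrow> j < ?N"
      proof (cases "?x \<in> \<int>")
        case True
        then obtain z where "?x = of_int z" by (auto elim: Ints_cases)
        then show ?thesis by (auto simp: lex_ceiling_def n)
      next
        case False
        then have "of_int j \<noteq> ?x" by (metis Ints_of_int)
        then show ?thesis using False by (auto simp: lex_ceiling_def n less_ceiling_iff)
      qed
      finally show ?thesis .
    qed
    \<comment> \<open>Since \<open>?N \<le> n\<close>, every \<open>j\<close> with
      \<open>0 \<le> j < ?N\<close> does occur as an index for \<open>\<alpha>\<close>.\<close>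
    have "{j \<in> I. (j, (\<beta>, m)) \<in> lt \<and> fst j = \<alpha>} = Pair \<alpha> ` {0..<?N}"
      using less Nn \<alpha> n by (auto simp: chain_index_def)
    then show ?thesis using N0 by (simp add: card_image inj_on_def)
  qed
qed

text \<open>Vectors of the same root have equal tails, so only the first entries decide. This
  supplies the value of the count at \<open>\<beta>\<close> itself.\<close>

lemma card_below_self:
  assumes i: "(\<beta>, m) \<in> I"
  shows "int (card {j \<in> I. (j, (\<beta>, m)) \<in> lt \<and> fst j = \<beta>}) = m"
proof -
  have irr: "(x, x) \<notin> lexord {(x::real, y). x < y}" for x by (rule lexord_irreflexive) auto
  have "((\<beta>, j), (\<beta>, m)) \<in> lt \<longleftrightarrow> j < m" if "(\<beta>, j) \<in> I" for j
  proof -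
    have "ht \<beta> > 0" using i by (auto simp: chain_index_def)
    then show ?thesis using i that irr by (simp add: chain_less_def chain_vec_def divide_less_cancel)
  qed
  then have "{j \<in> I. (j, (\<beta>, m)) \<in> lt \<and> fst j = \<beta>} = Pair \<beta> ` {0..<m}"
    using i by (auto simp: chain_index_def)
  then show ?thesis using i by (simp add: card_image inj_on_def chain_index_def)
qed

text \<open>For a negative root the count is made at the positive root \<open>- \<alpha>\<close>,
  and the convention in \<open>chain_count\<close> matches
  \<open>lex_ceiling_uminus\<close>.\<close>

lemma chain_count_eq_lex_ceiling:
  assumes \<alpha>: "\<alpha> \<in> real_roots B \<Delta>" and i: "(\<beta>, m) \<in> I" and ne: "\<alpha> \<noteq> \<beta>" "\<alpha> \<noteq> - \<beta>"
  shows "chain_count B \<Delta> I lt fst (\<beta>, m) \<alpha> = lex_ceiling \<beta> m \<alpha>"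
proof (cases "\<alpha> \<in> pos_roots B \<Delta>")
  case True
  then show ?thesis by (simp add: chain_count_def card_below_pos[OF _ i ne(1)])
next
  case False
  have \<beta>: "\<beta> \<in> real_roots B \<Delta>" using i by (auto simp: chain_index_def pos_root_real)
  have "- \<alpha> \<noteq> \<beta>" using ne(2) by auto
  then have "int (card {j \<in> I. (j, (\<beta>, m)) \<in> lt \<and> fst j = - \<alpha>}) = lex_ceiling \<beta> m (- \<alpha>)"
    by (rule card_below_pos[OF real_root_not_pos[OF \<alpha> False] i])
  then show ?thesis using False lex_ceiling_uminus[OF \<alpha> \<beta> ne] by (simp add: chain_count_def)
qed

lemma chain_count_add:
  assumes \<alpha>: "\<alpha> \<in> real_roots B \<Delta>" and \<gamma>: "\<gamma> \<in> real_roots B \<Delta>" and i: "(\<beta>, m) \<in> I"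
    and ne: "\<alpha> \<noteq> \<beta>" "\<alpha> \<noteq> - \<beta>" and eq: "coroot B \<gamma> = coroot B \<alpha> + of_int k *\<^sub>R coroot B \<beta>"
  shows "chain_count B \<Delta> I lt fst (\<beta>, m) \<gamma> =
    chain_count B \<Delta> I lt fst (\<beta>, m) \<alpha> + k * chain_count B \<Delta> I lt fst (\<beta>, m) \<beta>"
proof -
  have \<beta>: "\<beta> \<in> pos_roots B \<Delta>" "\<beta> \<in> real_roots B \<Delta>" "ht \<beta> > 0"
    using i by (auto simp: chain_index_def pos_root_real)
  \<comment> \<open>The ceiling formula must also apply to \<open>\<gamma>\<close>. If
    \<open>\<gamma>\<close> were \<open>\<beta>\<close> or \<open>- \<beta>\<close>, the coroot of
    \<open>\<alpha>\<close> would be a multiple of that of \<open>\<beta>\<close>.\<close>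
  have False if "\<gamma> = s *\<^sub>R \<beta>" "\<bar>s\<bar> = 1" for s
  proof -
    have "coroot B \<alpha> = (1 / s - of_int k) *\<^sub>R coroot B \<beta>"
      using eq that(1) by (simp add: coroot_scale algebra_simps)
    from coroot_proportional(3)[OF \<alpha> \<beta>(2) this] ne show False by blast
  qed
  from this[of 1] this[of "-1"] have "\<gamma> \<noteq> \<beta>" "\<gamma> \<noteq> - \<beta>" by auto
  then show ?thesis
    using lex_ceiling_add[OF \<alpha> \<beta>(2,3) eq] card_below_self[OF i] \<beta>(1)
    by (simp add: chain_count_eq_lex_ceiling[OF \<alpha> i ne] chain_count_eq_lex_ceiling[OF \<gamma> i])
      (simp add: chain_count_def)
qed

lemma lambda_chain_chain_less: "lambda_chain B \<Delta> lam I lt fst"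
  unfolding lambda_chain_def
proof (intro conjI ballI allI impI)
  fix \<alpha> \<beta> \<gamma> k i
  assume "\<alpha> \<in> real_roots B \<Delta>" "\<gamma> \<in> real_roots B \<Delta>" "i \<in> I" "\<alpha> \<noteq> \<beta>" "\<alpha> \<noteq> - \<beta>"
    "coroot B \<gamma> = coroot B \<alpha> + of_int k *\<^sub>R coroot B \<beta>" "fst i = \<beta>"
  then show "chain_count B \<Delta> I lt fst i \<gamma> =
      chain_count B \<Delta> I lt fst i \<alpha> + k * chain_count B \<Delta> I lt fst i \<beta>"
    using chain_count_add[of \<alpha> \<gamma> \<beta> "snd i"] by auto
next
  show "fst i \<in> pos_roots B \<Delta>" if "i \<in> I" for i
    using that by (auto simp: chain_index_def)
qed (fact chain_less_strict_linear chain_index_fiber)+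

end

theorem proposition4p2:
  fixes B :: "'v::real_vector \<Rightarrow> 'v \<Rightarrow> real"
    and \<Delta> :: "'v set" and ps :: "'v list" and lam :: 'v
  assumes "kac_moody_roots B \<Delta>"
    and "lam \<in> integral_weights B \<Delta>"
    and "dominant B \<Delta> lam"
    and "distinct ps" and "set ps = \<Delta>"
  shows "(\<forall>i \<in> chain_index B \<Delta> lam. set (chain_vec B \<Delta> ps lam i) \<subseteq> \<rat>) \<and>
    inj_on (chain_vec B \<Delta> ps lam) (chain_index B \<Delta> lam) \<and>
    lambda_chain B \<Delta> lam (chain_index B \<Delta> lam) (chain_less B \<Delta> ps lam) fst"
proof -
  interpret chain_setup B \<Delta> ps lam
    using assms by (simp add: chain_setup_def chain_setup_axioms_def)
  show ?thesis using chain_vec_in_Rats chain_vec_inj lambda_chain_chain_less by blast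
qed

end
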